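(* Let $\beta<0$ be a real number, let $t_0\in\mathbb{R}$, and let $f:[t_0,\infty)\to\mathbb{R}$ be a non-constant solution of the differential equation $$f'''+ff''-\beta f'^2=0 \quad\text{on } [t_0,\infty)$$ such that $\lim_{t\to\infty}f'(t)=0$. Suppose that $f$ is unbounded on $[t_0,\infty)$. Then there exists a constant $c>0$ such that $$|f(t)|\sim c\,t^{\frac{1}{1-\beta}}\quad\text{as } t\to\infty.$$
   Context: A solution on an interval is a real-valued, three times differentiable function satisfying the equation at every point of the interval. The notation $g(t)\sim h(t)$ as $t\to\infty$ means $\lim_{t\to\infty} g(t)/h(t)=1$. *)

theory Defs
  imports "HOL-Analysis.Analysis" "HOL-Library.Landau_Symbols"
begin

text \<open>
  Derivative relative to a set \<open>S\<close>: one-sided at an endpoint of an interval, and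
  independent of the values of \<open>f\<close> outside \<open>S\<close>. Only meaningful at points where \<open>f\<close>
  is differentiable within \<open>S\<close>.
\<close>

definition deriv_on :: "real set \<Rightarrow> (real \<Rightarrow> real) \<Rightarrow> real \<Rightarrow> real" where
  "deriv_on S f t = vector_derivative f (at t within S)"

definition three_times_differentiable_on :: "(real \<Rightarrow> real) \<Rightarrow> real set \<Rightarrow> bool" where
  "three_times_differentiable_on f S \<longleftrightarrow>
     (\<forall>k<3. ((deriv_on S ^^ k) f) differentiable_on S)"

definition is_solution_on :: "real \<Rightarrow> real set \<Rightarrow> (real \<Rightarrow> real) \<Rightarrow> bool" where
  "is_solution_on \<beta> S f \<longleftrightarrow>
     three_times_differentiable_on f S \<and>
     (\<forall>t\<in>S. (deriv_on S ^^ 3) f t + f t * (deriv_on S ^^ 2) f t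
             - \<beta> * (deriv_on S f t)\<^sup>2 = 0)"

end

theory Submission
  imports Defs
begin

text \<open>
  The equation says \<open>f''' + f f'' = \<beta> f'\<^sup>2 \<le> 0\<close>, so with \<open>F\<close> an antiderivative of
  \<open>f\<close> the quantity \<open>f'' e\<^sup>F\<close> is nonincreasing and \<open>f''\<close> has a fixed sign (in the
  weak sense) from some time on. As \<open>f' \<rightarrow> 0\<close>, this makes \<open>f\<close> eventually monotone, and since it
  is unbounded, \<open>g = s f\<close> is increasing, concave and tends to infinity for a suitable
  sign \<open>s = \<plusminus>1\<close>. Both signs can be treated together: with \<open>b = -\<beta> > 0\<close>, the function
  \<open>g\<close> solves \<open>s g''' + g g'' + b g'\<^sup>2 = 0\<close>.

  If \<open>g'''\<close> were absent, this would say \<open>(g\<^sup>b g')' = 0\<close>, hence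
  \<open>g\<^sup>b\<^sup>+\<^sup>1\<close> would grow linearly and \<open>g\<close> like \<open>t\<close> to the power \<open>1 / (b + 1)\<close>. To show
  that \<open>g'''\<close> is a negligible perturbation, one corrects \<open>g\<^sup>b g'\<close> to
  \<open>W = g\<^sup>b g' + s g\<^sup>b\<^sup>-\<^sup>1 g''\<close>, which removes \<open>g'''\<close> from the derivative:
  \<open>W' = s (b - 1) g\<^sup>b\<^sup>-\<^sup>2 g' g''\<close>. Everything then rests on the bound
  \<open>\<bar>g''\<bar> \<le> g'\<close> for large \<open>t\<close> (\<open>curvature_dominated_by_slope\<close>). It
  makes \<open>W\<close> asymptotic to \<open>g\<^sup>b g'\<close> and gives \<open>\<bar>(ln W)'\<bar> \<le> C g' / g\<^sup>2\<close>. The right-hand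
  side is the derivative of the bounded function \<open>- C / g\<close>, so \<open>ln W\<close> converges and
  \<open>g\<^sup>b g'\<close> has a positive limit (\<open>power_weighted_slope_convergent\<close>). L'Hospital's rule
  turns this limit into the asymptotics of \<open>g\<close> (\<open>power_growth_from_weighted_slope\<close>).

  The bound on the curvature holds because \<open>(g' + g'')' = s g' (g - s - b g')\<close> wherever
  \<open>g' + g'' = 0\<close>, so that for large \<open>t\<close> the sign of \<open>g' + g''\<close> can change in one direction
  only; and \<open>g' + g''\<close> cannot stay nonpositive, for then \<open>g + g'\<close> would be nonincreasing
  and \<open>g\<close> bounded above.
\<close>

section \<open>Functions with a derivative on a ray\<close>

lemma continuous_on_if_has_derivative_on_ray:
  fixes h h' :: "real \<Rightarrow> real"
  assumes "\<And>t. t \<ge> a \<Longrightarrow> (h has_real_derivative h' t) (at t)" and "S \<subseteq> {a..}"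
  shows "continuous_on S h"
  using assms by (intro continuous_at_imp_continuous_on) (auto intro!: DERIV_isCont)

lemma nondecreasing_on_ray:
  fixes h h' :: "real \<Rightarrow> real"
  assumes "\<And>t. t \<ge> a \<Longrightarrow> (h has_real_derivative h' t) (at t)"
    and "\<And>t. t \<ge> a \<Longrightarrow> h' t \<ge> 0" and "a \<le> x" "x \<le> y"
  shows "h x \<le> h y"
  using assms(4) by (rule DERIV_nonneg_imp_nondecreasing) (meson assms(1-3) order_trans)

lemma nonincreasing_on_ray:
  fixes h h' :: "real \<Rightarrow> real"
  assumes "\<And>t. t \<ge> a \<Longrightarrow> (h has_real_derivative h' t) (at t)"
    and "\<And>t. t \<ge> a \<Longrightarrow> h' t \<le> 0" and "a \<le> x" "x \<le> y"
  shows "h y \<le> h x"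
  using assms(4) by (rule DERIV_nonpos_imp_nonincreasing) (meson assms(1-3) order_trans)

text \<open>
  A barrier argument: at the last time before \<open>t\<close> at which \<open>h\<close> is nonnegative it has to
  vanish, and there it would immediately become positive again.
\<close>

lemma nonneg_if_increasing_at_zeros:
  fixes h h' :: "real \<Rightarrow> real"
  assumes deriv: "\<And>t. t \<ge> a \<Longrightarrow> (h has_real_derivative h' t) (at t)"
    and start: "h a \<ge> 0"
    and zero: "\<And>t. t \<ge> a \<Longrightarrow> h t = 0 \<Longrightarrow> h' t > 0"
    and "t \<ge> a"
  shows "h t \<ge> 0"
proof (rule ccontr)
  assume neg: "\<not> h t \<ge> 0"
  have cont: "continuous_on {u..t} h" if "u \<ge> a" for u
    by (rule continuous_on_if_has_derivative_on_ray[OF deriv]) (use that in auto)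
  define S where "S = {u \<in> {a..t}. 0 \<le> h u}"
  have "closed S"
    unfolding S_def by (rule continuous_on_closed_Collect_le) (use cont in auto)
  moreover have "bounded S"
    by (rule bounded_subset[of "{a..t}"]) (auto simp: S_def)
  ultimately have "compact S" by (simp add: compact_eq_bounded_closed)
  moreover have "S \<noteq> {}" using start \<open>t \<ge> a\<close> by (auto simp: S_def)
  ultimately obtain s where s: "s \<in> S" and s_max: "\<And>u. u \<in> S \<Longrightarrow> u \<le> s"
    by (metis compact_attains_sup)
  hence sa: "a \<le> s" and st: "s < t" and hs: "h s \<ge> 0"
    using neg by (auto simp: S_def less_eq_real_def)
  obtain r where r: "s \<le> r" "r \<le> t" "h r = 0"
    using IVT2'[of h t 0 s] neg hs st cont[OF sa] by auto
  hence "r \<in> S" using sa by (auto simp: S_def)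
  hence "h s = 0" using s_max r by force
  then obtain d where d: "d > 0" "\<And>e. 0 < e \<Longrightarrow> e < d \<Longrightarrow> h s < h (s + e)"
    using DERIV_pos_inc_right[OF deriv[OF sa] zero[OF sa]] by blast
  define e where "e = min (d / 2) (t - s)"
  have e: "0 < e" "e < d" "s + e \<le> t" using d(1) st by (auto simp: e_def)
  hence "s + e \<in> S" using d(2)[of e] \<open>h s = 0\<close> sa by (auto simp: S_def)
  thus False using s_max e by force
qed

lemma filterlim_at_top_if_mono_unbounded:
  fixes g :: "real \<Rightarrow> real"
  assumes "\<And>x y. a \<le> x \<Longrightarrow> x \<le> y \<Longrightarrow> g x \<le> g y"
    and "\<not> bdd_above (g ` {a..})"
  shows "filterlim g at_top at_top"
  unfolding filterlim_at_top eventually_at_top_linorder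
proof
  fix K
  obtain x where "x \<ge> a" "g x > K"
    using assms(2) by (auto simp: bdd_above_def not_le)
  thus "\<exists>N. \<forall>n\<ge>N. K \<le> g n"
    by (intro exI[of _ x]) (meson assms(1) less_imp_le order_trans)
qed

text \<open>
  Integrability of \<open>L'\<close> at infinity, expressed through a majorant \<open>p'\<close> whose primitive
  \<open>p\<close> converges: \<open>L + p\<close> increases while \<open>L - p\<close> decreases, and the two differ by the
  bounded quantity \<open>2 p\<close>.
\<close>

lemma convergent_if_derivative_dominated:
  fixes L L' p p' :: "real \<Rightarrow> real"
  assumes dL: "\<And>t. t \<ge> a \<Longrightarrow> (L has_real_derivative L' t) (at t)"
    and dp: "\<And>t. t \<ge> a \<Longrightarrow> (p has_real_derivative p' t) (at t)"
    and dom: "\<And>t. t \<ge> a \<Longrightarrow> \<bar>L' t\<bar> \<le> p' t"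
    and lim: "(p \<longlongrightarrow> P) at_top"
  shows "\<exists>l. (L \<longlongrightarrow> l) at_top"
proof -
  have up: "L x + p x \<le> L y + p y" if "a \<le> x" "x \<le> y" for x y
    by (rule nondecreasing_on_ray[OF DERIV_add[OF dL dp] _ that])
      (use dom in \<open>force simp: abs_le_iff\<close>)+
  have down: "L y - p y \<le> L x - p x" if "a \<le> x" "x \<le> y" for x y
    by (rule nonincreasing_on_ray[OF DERIV_diff[OF dL dp] _ that])
      (use dom in \<open>force simp: abs_le_iff\<close>)+
  define A where "A t = L t + p t" for t
  have "\<forall>\<^sub>F t in at_top. p t < P + 1" by (rule order_tendstoD[OF lim]) simp
  then obtain N where N: "\<And>t. t \<ge> N \<Longrightarrow> p t < P + 1"
    by (auto simp: eventually_at_top_linorder)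
  have bound: "A t \<le> L a - p a + 2 * (P + 1)" if "t \<ge> a" for t
    using up[of t "max t N"] down[of a "max t N"] N[of "max t N"] that
    by (simp add: A_def le_max_iff_disj)
  have bdd: "bdd_above (A ` {a..})" using bound by (auto simp: bdd_above_def)
  have "(A \<longlongrightarrow> Sup (A ` {a..})) at_top"
  proof (rule increasing_tendsto)
    show "\<forall>\<^sub>F t in at_top. A t \<le> Sup (A ` {a..})"
      using eventually_ge_at_top[of a] by eventually_elim (auto intro: cSup_upper bdd)
  next
    fix x assume "x < Sup (A ` {a..})"
    then obtain u where u: "u \<ge> a" "x < A u"
      by (subst (asm) less_cSup_iff) (use bdd in auto)
    show "\<forall>\<^sub>F t in at_top. x < A t"
      using eventually_ge_at_top[of u] 
      by eventually_elim (use up[of u] u in \<open>force simp: A_def\<close>)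
  qed
  hence "((\<lambda>t. A t - p t) \<longlongrightarrow> Sup (A ` {a..}) - P) at_top" by (intro tendsto_intros lim)
  thus ?thesis by (auto simp: A_def)
qed

section \<open>Reduction to an increasing concave function\<close>

text \<open>
  The derivatives along the ray are one-sided only at its endpoint; at later times they
  are ordinary ones.
\<close>

lemma solution_derivatives:
  assumes "is_solution_on \<beta> {t\<^sub>0..} f" "t > t\<^sub>0"
  defines "D \<equiv> deriv_on {t\<^sub>0..}"
  shows "(f has_real_derivative D f t) (at t)"
    and "(D f has_real_derivative D (D f) t) (at t)"
    and "(D (D f) has_real_derivative D (D (D f)) t) (at t)"
    and "D (D (D f)) t + f t * D (D f) t - \<beta> * (D f t)\<^sup>2 = 0"
proof -
  have D: "(g has_real_derivative D g t) (at t)" if "g differentiable_on {t\<^sub>0..}" for g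
  proof -
    have "g differentiable (at t within {t\<^sub>0..})"
      using that assms(2) by (auto simp: differentiable_on_def)
    hence "(g has_real_derivative D g t) (at t within {t\<^sub>0..})"
      unfolding D_def deriv_on_def
      by (simp add: vector_derivative_works has_real_derivative_iff_has_vector_derivative)
    moreover have "at t within {t\<^sub>0..} = at t"
      by (rule at_within_interior) (use assms(2) in \<open>simp add: interior_real_atLeast\<close>)
    ultimately show ?thesis by simp
  qed
  have diff: "((D ^^ k) f) differentiable_on {t\<^sub>0..}" if "k < 3" for k
    using assms(1) that by (simp add: D_def is_solution_on_def three_times_differentiable_on_def)
  show "(f has_real_derivative D f t) (at t)"
    and "(D f has_real_derivative D (D f) t) (at t)"
    and "(D (D f) has_real_derivative D (D (D f)) t) (at t)"
    using diff[of 0] diff[of 1] diff[of 2] by (simp_all add: D numeral_2_eq_2)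
  show "D (D (D f)) t + f t * D (D f) t - \<beta> * (D f t)\<^sup>2 = 0"
    using assms(1,2) by (simp add: D_def is_solution_on_def numeral_eq_Suc)
qed

text \<open>
  The differential inequality says that \<open>f'' e\<^sup>F\<close> is nonincreasing, where \<open>F\<close> is an
  antiderivative of \<open>f\<close>.
\<close>

lemma second_derivative_stays_negative:
  fixes f f1 f2 f3 :: "real \<Rightarrow> real"
  assumes d0: "\<And>t. t \<ge> a \<Longrightarrow> (f has_real_derivative f1 t) (at t)"
    and d2: "\<And>t. t \<ge> a \<Longrightarrow> (f2 has_real_derivative f3 t) (at t)"
    and ineq: "\<And>t. t \<ge> a \<Longrightarrow> f3 t + f t * f2 t \<le> 0"
    and neg: "f2 a < 0" and "t \<ge> a"
  shows "f2 t < 0"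
proof -
  have "continuous_on {a..t} f"
    by (rule continuous_on_if_has_derivative_on_ray[OF d0]) auto
  then obtain F where F: "\<And>x. x \<in> {a..t} \<Longrightarrow> (F has_vector_derivative f x) (at x within {a..t})"
    using antiderivative_continuous by blast
  have "f2 t * exp (F t) \<le> f2 a * exp (F a)"
  proof (rule DERIV_nonpos_imp_decreasing_open[OF \<open>a \<le> t\<close>])
    fix x assume x: "a < x" "x < t"
    have "(F has_real_derivative f x) (at x)"
      using F[of x] x 
      by (simp add: has_real_derivative_iff_has_vector_derivative at_within_Icc_at)
    hence "((\<lambda>x. f2 x * exp (F x)) has_real_derivative
             (f3 x + f x * f2 x) * exp (F x)) (at x)"
      using d2[of x] x by (auto intro!: derivative_eq_intros simp: algebra_simps)
    moreover have "(f3 x + f x * f2 x) * exp (F x) \<le> 0"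
      using ineq[of x] x by (simp add: mult_nonpos_nonneg)
    ultimately show "\<exists>y. ((\<lambda>x. f2 x * exp (F x)) has_real_derivative y) (at x) \<and> y \<le> 0"
      by blast
  next
    have "continuous_on {a..t} F"
      by (rule continuous_on_vector_derivative[OF F])
    moreover have "continuous_on {a..t} f2"
      by (rule continuous_on_if_has_derivative_on_ray[OF d2]) auto
    ultimately show "continuous_on {a..t} (\<lambda>x. f2 x * exp (F x))"
      by (intro continuous_intros)
  qed
  also have "\<dots> < 0" using neg by (simp add: mult_neg_pos)
  finally show ?thesis by (simp add: mult_less_0_iff)
qed

text \<open>
  By the preceding lemma, \<open>f''\<close> is either negative from some time on or nonnegative
  throughout; the sign \<open>s\<close> is \<open>1\<close> in the first case, where \<open>f\<close> tends to \<open>\<infinity>\<close>, and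
  \<open>-1\<close> in the second, where it tends to \<open>-\<infinity>\<close>. The slope of \<open>s f\<close> decreases to \<open>0\<close>
  and is therefore nonnegative. If it vanished once, it would vanish ever after and \<open>f\<close>
  would be bounded.
\<close>

lemma monotone_concave_normal_form:
  fixes f f1 f2 f3 :: "real \<Rightarrow> real"
  assumes d0: "\<And>t. t \<ge> a \<Longrightarrow> (f has_real_derivative f1 t) (at t)"
    and d1: "\<And>t. t \<ge> a \<Longrightarrow> (f1 has_real_derivative f2 t) (at t)"
    and d2: "\<And>t. t \<ge> a \<Longrightarrow> (f2 has_real_derivative f3 t) (at t)"
    and ineq: "\<And>t. t \<ge> a \<Longrightarrow> f3 t + f t * f2 t \<le> 0"
    and lim: "(f1 \<longlongrightarrow> 0) at_top"
    and unb: "\<not> bounded (f ` {a..})"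
  obtains s T where "s = 1 \<or> s = -1" "T \<ge> a"
    and "\<And>t. t \<ge> T \<Longrightarrow> s * f1 t > 0" "\<And>t. t \<ge> T \<Longrightarrow> s * f2 t \<le> 0"
    and "filterlim (\<lambda>t. s * f t) at_top at_top"
proof -
  obtain s T where s: "s = 1 \<or> s = (-1::real)" and T: "T \<ge> a"
    and concave: "\<And>t. t \<ge> T \<Longrightarrow> s * f2 t \<le> 0"
  proof (cases "\<exists>T\<ge>a. f2 T < 0")
    case True
    then obtain T where "T \<ge> a" "f2 T < 0" by blast
    hence "f2 t \<le> 0" if "t \<ge> T" for t
      using second_derivative_stays_negative[of T f f1 f2 f3 t] d0 d2 ineq that
      by (simp add: less_imp_le)
    thus ?thesis using that[of 1 T] \<open>T \<ge> a\<close> by simp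
  next
    case False
    thus ?thesis using that[of "-1" a] by (auto simp: not_less)
  qed
  have unbT: "\<not> bounded (f ` {T..})"
  proof
    assume "bounded (f ` {T..})"
    moreover have "bounded (f ` {a..T})"
      by (intro compact_imp_bounded compact_continuous_image
          continuous_on_if_has_derivative_on_ray[OF d0]) auto
    ultimately have "bounded (f ` {a..T} \<union> f ` {T..})" by simp
    moreover have "{a..} = {a..T} \<union> {T..}" using T by auto
    ultimately show False using unb by (simp add: image_Un)
  qed
  have anti: "s * f1 y \<le> s * f1 x" if "T \<le> x" "x \<le> y" for x y
    by (rule nonincreasing_on_ray[OF DERIV_cmult[OF d1] concave that]) (use T in auto)
  have lim': "((\<lambda>t. s * f1 t) \<longlongrightarrow> 0) at_top"
    using tendsto_mult_right_zero[OF lim] by simp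
  have nonneg: "s * f1 x \<ge> 0" if "T \<le> x" for x
    by (rule tendsto_upperbound[OF lim'])
      (use anti that in \<open>auto simp: eventually_at_top_linorder\<close>)
  have mono: "s * f x \<le> s * f y" if "T \<le> x" "x \<le> y" for x y
    by (rule nondecreasing_on_ray[OF DERIV_cmult[OF d0] nonneg that]) (use T in auto)
  have unb_above: "\<not> bdd_above ((\<lambda>t. s * f t) ` {u..})" if "u \<ge> T" for u
  proof
    assume "bdd_above ((\<lambda>t. s * f t) ` {u..})"
    then obtain K where K: "s * f t \<le> K" if "t \<ge> u" for t
      by (auto simp: bdd_above_def)
    have "s * f t \<le> K" if "t \<ge> T" for t
      using K[of "max t u"] mono[of t "max t u"] that by linarith
    moreover have "s * f T \<le> s * f t" if "t \<ge> T" for t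
      using mono that by blast
    ultimately have sandwich: "s * f T \<le> s * f t \<and> s * f t \<le> K" if "t \<ge> T" for t
      using that by blast
    have "\<bar>f t\<bar> \<le> \<bar>K\<bar> + \<bar>f T\<bar>" if "t \<ge> T" for t
      using s sandwich[OF that] by auto
    hence "bounded (f ` {T..})" by (auto simp: bounded_iff)
    thus False using unbT by simp
  qed
  have "s * f1 t > 0" if "t \<ge> T" for t
  proof (rule ccontr)
    assume "\<not> s * f1 t > 0"
    hence flat: "s * f1 x \<le> 0" if "x \<ge> t" for x
      using anti[of t x] \<open>t \<ge> T\<close> that by linarith
    have "s * f x \<le> s * f t" if "x \<ge> t" for x
      by (rule nonincreasing_on_ray[OF DERIV_cmult[OF d0] flat order_refl that])
        (use T \<open>t \<ge> T\<close> in auto)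
    hence "bdd_above ((\<lambda>t. s * f t) ` {t..})" by (auto simp: bdd_above_def)
    thus False using unb_above[OF that] by simp
  qed
  moreover have "filterlim (\<lambda>t. s * f t) at_top at_top"
    by (rule filterlim_at_top_if_mono_unbounded[OF mono unb_above[of T]]) auto
  ultimately show thesis using that s T concave by blast
qed

section \<open>The limit of the weighted slope\<close>

text \<open>
  The sign of \<open>g' + g''\<close> is controlled by its derivative at its zeros, which for large
  \<open>t\<close> has the sign of \<open>s\<close>. So \<open>g' + g''\<close> stays nonnegative once it is so if \<open>s = 1\<close>, and
  stays nonpositive once it is so if \<open>s = -1\<close>. On the other hand \<open>g' + g''\<close> is positive
  at arbitrarily late times, since otherwise its primitive \<open>g + g'\<close> would be bounded above.
  For \<open>s = 1\<close> this provides the starting point, for \<open>s = -1\<close> the contradiction.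
\<close>

lemma curvature_dominated_by_slope:
  fixes g g1 g2 g3 :: "real \<Rightarrow> real"
  assumes s: "s = 1 \<or> s = (-1::real)"
    and d0: "\<And>t. t \<ge> a \<Longrightarrow> (g has_real_derivative g1 t) (at t)"
    and d1: "\<And>t. t \<ge> a \<Longrightarrow> (g1 has_real_derivative g2 t) (at t)"
    and d2: "\<And>t. t \<ge> a \<Longrightarrow> (g2 has_real_derivative g3 t) (at t)"
    and ode: "\<And>t. t \<ge> a \<Longrightarrow> s * g3 t + g t * g2 t + b * (g1 t)\<^sup>2 = 0"
    and pos: "\<And>t. t \<ge> a \<Longrightarrow> g1 t > 0"
    and lim: "(g1 \<longlongrightarrow> 0) at_top"
    and inf: "filterlim g at_top at_top"
  shows "\<forall>\<^sub>F t in at_top. - g2 t \<le> g1 t"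
proof -
  have "((\<lambda>t. \<bar>b * g1 t\<bar>) \<longlongrightarrow> 0) at_top"
    using tendsto_rabs_zero[OF tendsto_mult_right_zero[OF lim]] by simp
  hence "\<forall>\<^sub>F t in at_top. \<bar>b * g1 t\<bar> < 1" by (rule order_tendstoD) simp
  moreover have "\<forall>\<^sub>F t in at_top. g t > 2" using inf by (simp add: filterlim_at_top_dense)
  ultimately have "\<forall>\<^sub>F t in at_top. a \<le> t \<and> 1 + \<bar>b * g1 t\<bar> < g t"
    using eventually_ge_at_top[of a] by eventually_elim auto
  then obtain T where T: "\<And>t. t \<ge> T \<Longrightarrow> a \<le> t" "\<And>t. t \<ge> T \<Longrightarrow> 1 + \<bar>b * g1 t\<bar> < g t"
    by (auto simp: eventually_at_top_linorder)
  have dh: "((\<lambda>t. g1 t + g2 t) has_real_derivative g2 t + g3 t) (at t)" if "t \<ge> T" for t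
    using d1 d2 T that by (auto intro!: derivative_eq_intros)
  have not_below: "\<exists>t\<ge>u. g1 t + g2 t > 0" if "u \<ge> T" for u
  proof (rule ccontr)
    assume "\<not> ?thesis"
    hence le: "g1 t + g2 t \<le> 0" if "t \<ge> u" for t using that by (auto simp: not_less)
    have "g t + g1 t \<le> g u + g1 u" if "t \<ge> u" for t
      by (rule nonincreasing_on_ray[OF DERIV_add[OF d0 d1] le order_refl that])
        (use T \<open>u \<ge> T\<close> in auto)
    hence "g t \<le> g u + g1 u" if "t \<ge> u" for t
      using pos[of t] T \<open>u \<ge> T\<close> that by (smt (verit))
    moreover have "\<forall>\<^sub>F t in at_top. g t > g u + g1 u"
      using inf by (simp add: filterlim_at_top_dense)
    hence "\<forall>\<^sub>F t in at_top. t \<ge> u \<and> g t > g u + g1 u"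
      using eventually_ge_at_top[of u] by eventually_elim auto
    then obtain t where "t \<ge> u" "g t > g u + g1 u"
      by (auto simp: eventually_at_top_linorder)
    ultimately show False by force
  qed
  \<comment> \<open>The equation, with \<open>g'' = - g'\<close> inserted, determines \<open>g'''\<close>.\<close>
  have at_zero: "s * (g2 t + g3 t) > 0" if "t \<ge> T" "g1 t + g2 t = 0" for t
  proof -
    have g2: "g2 t = - g1 t" using that by simp
    have "s * g3 t = g1 t * (g t - b * g1 t)"
      using ode[of t] T(1)[OF that(1)] g2 by (simp add: algebra_simps power2_eq_square)
    hence "s * (g2 t + g3 t) = g1 t * (g t - s - b * g1 t)"
      using g2 by (simp add: algebra_simps)
    moreover have "g t - s - b * g1 t > 0" using T(2)[OF that(1)] s by auto
    ultimately show ?thesis using pos[OF T(1)[OF that(1)]] by simp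
  qed
  from s have "\<exists>u\<ge>T. \<forall>t\<ge>u. g1 t + g2 t \<ge> 0"
  proof
    assume "s = 1"
    obtain u where u: "u \<ge> T" "g1 u + g2 u > 0" using not_below by blast
    have "g1 t + g2 t \<ge> 0" if "t \<ge> u" for t
      by (rule nonneg_if_increasing_at_zeros[OF dh _ _ that])
        (use u at_zero \<open>s = 1\<close> in auto)
    thus ?thesis using u by blast
  next
    assume "s = -1"
    have "g1 u + g2 u \<ge> 0" if u: "u \<ge> T" for u
    proof (rule ccontr)
      assume neg: "\<not> g1 u + g2 u \<ge> 0"
      have "- (g1 t + g2 t) \<ge> 0" if "t \<ge> u" for t
        by (rule nonneg_if_increasing_at_zeros[OF DERIV_minus[OF dh] _ _ that])
          (use u neg at_zero \<open>s = -1\<close> in auto)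
      thus False using not_below[OF u] by force
    qed
    thus ?thesis by blast
  qed
  then obtain u where "\<And>t. t \<ge> u \<Longrightarrow> g1 t + g2 t \<ge> 0" by blast
  thus ?thesis unfolding eventually_at_top_linorder by (intro exI[of _ u]) force
qed

text \<open>
  The function \<open>W\<close> below arises by writing the equation as
  \<open>(g\<^sup>b g')' = - s g\<^sup>b\<^sup>-\<^sup>1 g'''\<close> and integrating the right-hand side by parts once. With
  \<open>q = s g'' / g'\<close>, which is bounded by \<open>1\<close>, it factors as \<open>W = g\<^sup>b g' r\<close> with
  \<open>r = 1 + q / g\<close>, and its logarithmic derivative is \<open>(b - 1) (g' / g\<^sup>2) (q / r)\<close>. Passing
  to the logarithm ensures that the limit is not zero.
\<close>

lemma power_weighted_slope_convergent:
  fixes g g1 g2 g3 :: "real \<Rightarrow> real"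
  assumes s: "s = 1 \<or> s = (-1::real)"
    and d0: "\<And>t. t \<ge> a \<Longrightarrow> (g has_real_derivative g1 t) (at t)"
    and d1: "\<And>t. t \<ge> a \<Longrightarrow> (g1 has_real_derivative g2 t) (at t)"
    and d2: "\<And>t. t \<ge> a \<Longrightarrow> (g2 has_real_derivative g3 t) (at t)"
    and ode: "\<And>t. t \<ge> a \<Longrightarrow> s * g3 t + g t * g2 t + b * (g1 t)\<^sup>2 = 0"
    and pos: "\<And>t. t \<ge> a \<Longrightarrow> g1 t > 0"
    and bound: "\<And>t. t \<ge> a \<Longrightarrow> \<bar>g2 t\<bar> \<le> g1 t"
    and inf: "filterlim g at_top at_top"
  shows "\<exists>w>0. ((\<lambda>t. g t powr b * g1 t) \<longlongrightarrow> w) at_top"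
proof -
  \<comment> \<open>The threshold \<open>2\<close> gives \<open>r \<ge> 1/2\<close>, which keeps \<open>W\<close> positive.\<close>
  have "\<forall>\<^sub>F t in at_top. g t > 2" using inf by (simp add: filterlim_at_top_dense)
  hence "\<forall>\<^sub>F t in at_top. a \<le> t \<and> g t > 2"
    using eventually_ge_at_top[of a] by eventually_elim auto
  then obtain T where T: "\<And>t. t \<ge> T \<Longrightarrow> a \<le> t" "\<And>t. t \<ge> T \<Longrightarrow> g t > 2"
    by (auto simp: eventually_at_top_linorder)
  define W where "W t = g t powr b * g1 t + s * (g t powr (b - 1) * g2 t)" for t
  define W' where "W' t = s * (b - 1) * g t powr (b - 2) * g1 t * g2 t" for t
  define q where "q t = s * (g2 t / g1 t)" for t
  define r where "r t = 1 + q t / g t" for t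
  have W_eq: "W t = g t powr b * g1 t * r t" if "t \<ge> T" for t
    using T[OF that] pos[OF T(1)[OF that]]
    by (simp add: W_def r_def q_def powr_diff field_simps)
  have q: "\<bar>q t\<bar> \<le> 1" if "t \<ge> T" for t
    using bound[OF T(1)[OF that]] pos[OF T(1)[OF that]] s by (auto simp: q_def field_simps)
  have qg: "\<bar>q t / g t\<bar> \<le> 1 / g t" if "t \<ge> T" for t
    using q[OF that] T(2)[OF that] by (simp add: divide_right_mono)
  have r_ge: "r t \<ge> 1 / 2" if "t \<ge> T" for t
  proof -
    have "1 / g t \<le> 1 / 2" using T(2)[OF that] by (simp add: field_simps)
    thus ?thesis using qg[OF that] unfolding r_def by linarith
  qed
  have W_pos: "W t > 0" if "t \<ge> T" for t
    using r_ge[OF that] pos[OF T(1)[OF that]] T(2)[OF that] by (auto simp: W_eq[OF that])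
  have dW: "(W has_real_derivative W' t) (at t)" if "t \<ge> T" for t
  proof -
    have g: "g t > 0" and ta: "t \<ge> a" using T[OF that] by auto
    have "(W has_real_derivative
        (b * g t powr (b - 1) * g1 t * g1 t + g t powr b * g2 t)
        + s * ((b - 1) * g t powr (b - 2) * g1 t * g2 t + g t powr (b - 1) * g3 t)) (at t)"
      unfolding W_def
      apply (rule derivative_eq_intros DERIV_powr d0 d1 d2 ta g refl)+
      using g by (simp add: algebra_simps powr_diff power2_eq_square)
    also have "(b * g t powr (b - 1) * g1 t * g1 t + g t powr b * g2 t)
        + s * ((b - 1) * g t powr (b - 2) * g1 t * g2 t + g t powr (b - 1) * g3 t)
      = W' t + g t powr (b - 1) * (s * g3 t + g t * g2 t + b * (g1 t)\<^sup>2)"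
      using g by (simp add: W'_def powr_diff field_simps power2_eq_square)
    finally show ?thesis by (simp add: ode[OF ta])
  qed
  have "\<exists>l. ((\<lambda>t. ln (W t)) \<longlongrightarrow> l) at_top"
  proof (rule convergent_if_derivative_dominated)
    fix t assume t: "t \<ge> T"
    have g: "g t > 0" and ta: "t \<ge> a" using T[OF t] by auto
    show "((\<lambda>t. ln (W t)) has_real_derivative W' t / W t) (at t)"
      using dW[OF t] W_pos[OF t] by (auto intro!: derivative_eq_intros simp: field_simps)
    show "((\<lambda>t. - 2 * \<bar>b - 1\<bar> / g t) has_real_derivative 2 * \<bar>b - 1\<bar> * g1 t / (g t)\<^sup>2) (at t)"
      using d0[OF ta] g by (auto intro!: derivative_eq_intros simp: power2_eq_square)
    have "W' t / W t = ((b - 1) * (g1 t / (g t)\<^sup>2)) * (q t / r t)"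
      using g pos[OF ta] r_ge[OF t]
      by (simp add: W_eq[OF t] W'_def q_def powr_diff field_simps power2_eq_square)
    hence "\<bar>W' t / W t\<bar> = (\<bar>b - 1\<bar> * (g1 t / (g t)\<^sup>2)) * (\<bar>q t\<bar> / r t)"
      using g pos[OF ta] r_ge[OF t] by (simp add: abs_mult)
    also have "\<dots> \<le> (\<bar>b - 1\<bar> * (g1 t / (g t)\<^sup>2)) * (1 / (1/2))"
      by (intro mult_left_mono frac_le) (use q[OF t] r_ge[OF t] pos[OF ta] in auto)
    finally show "\<bar>W' t / W t\<bar> \<le> 2 * \<bar>b - 1\<bar> * g1 t / (g t)\<^sup>2" by (simp add: ac_simps)
  next
    show "((\<lambda>t. - 2 * \<bar>b - 1\<bar> / g t) \<longlongrightarrow> 0) at_top"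
      by (intro tendsto_divide_0[OF tendsto_const] filterlim_at_top_imp_at_infinity inf)
  qed
  then obtain l where l: "((\<lambda>t. ln (W t)) \<longlongrightarrow> l) at_top" by blast
  have "((\<lambda>t. exp (ln (W t))) \<longlongrightarrow> exp l) at_top" by (intro tendsto_intros l)
  hence W_lim: "(W \<longlongrightarrow> exp l) at_top"
    by (rule Lim_transform_eventually)
      (use W_pos in \<open>auto simp: eventually_at_top_linorder intro!: exI[of _ T]\<close>)
  have "((\<lambda>t. q t / g t) \<longlongrightarrow> 0) at_top"
  proof (rule Lim_null_comparison)
    show "\<forall>\<^sub>F t in at_top. norm (q t / g t) \<le> 1 / g t"
      using eventually_ge_at_top[of T] by eventually_elim (use qg in auto)
    show "((\<lambda>t. 1 / g t) \<longlongrightarrow> 0) at_top"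
      by (intro tendsto_divide_0[OF tendsto_const] filterlim_at_top_imp_at_infinity inf)
  qed
  hence "(r \<longlongrightarrow> 1) at_top"
    unfolding r_def using tendsto_add[OF tendsto_const[of 1]] by fastforce
  hence "((\<lambda>t. W t / r t) \<longlongrightarrow> exp l) at_top"
    using tendsto_divide[OF W_lim] by fastforce
  hence "((\<lambda>t. g t powr b * g1 t) \<longlongrightarrow> exp l) at_top"
    by (rule Lim_transform_eventually)
      (use eventually_ge_at_top[of T] in \<open>eventually_elim, use W_eq r_ge in force\<close>)
  thus ?thesis by (intro exI[of _ "exp l"]) simp
qed

section \<open>Power growth\<close>

text \<open>
  Up to the factor \<open>b + 1\<close>, the weighted slope is the derivative of \<open>g\<^sup>b\<^sup>+\<^sup>1\<close>, so
  L'Hospital's rule compares \<open>g\<^sup>b\<^sup>+\<^sup>1\<close> with \<open>t\<close>.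
\<close>

lemma power_growth_from_weighted_slope:
  fixes g g1 :: "real \<Rightarrow> real"
  assumes b: "b > -1"
    and d0: "\<And>t. t \<ge> a \<Longrightarrow> (g has_real_derivative g1 t) (at t)"
    and inf: "filterlim g at_top at_top"
    and w: "w > 0" and lim: "((\<lambda>t. g t powr b * g1 t) \<longlongrightarrow> w) at_top"
  shows "g \<sim>[at_top] (\<lambda>t. ((b + 1) * w) powr (1 / (b + 1)) * t powr (1 / (b + 1)))"
proof -
  have g_pos: "\<forall>\<^sub>F t in at_top. g t > 0" using inf by (simp add: filterlim_at_top_dense)
  have "((\<lambda>t. g t powr (b + 1) / t) \<longlongrightarrow> (b + 1) * w) at_top"
  proof (rule lhospital_at_top_at_top)
    show "\<forall>\<^sub>F t in at_top. ((\<lambda>t. g t powr (b + 1)) has_real_derivative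
            (b + 1) * (g t powr b * g1 t)) (at t)"
      using g_pos eventually_ge_at_top[of a]
    proof eventually_elim
      case (elim t)
      show ?case
        using DERIV_fun_powr[OF d0, of t "b + 1"] elim by (simp add: mult.assoc)
    qed
    show "((\<lambda>t. (b + 1) * (g t powr b * g1 t) / 1) \<longlongrightarrow> (b + 1) * w) at_top"
      using tendsto_mult_left[OF lim] by simp
  qed (simp_all add: filterlim_ident)
  hence "((\<lambda>t. (g t powr (b + 1) / t) powr (1 / (b + 1))) \<longlongrightarrow>
           ((b + 1) * w) powr (1 / (b + 1))) at_top"
    by (rule tendsto_powr) (use b w in auto)
  hence "((\<lambda>t. g t / t powr (1 / (b + 1))) \<longlongrightarrow> ((b + 1) * w) powr (1 / (b + 1))) at_top"
  proof (rule Lim_transform_eventually)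
    show "\<forall>\<^sub>F t in at_top. (g t powr (b + 1) / t) powr (1 / (b + 1)) = g t / t powr (1 / (b + 1))"
      using g_pos eventually_gt_at_top[of 0]
      by eventually_elim (use b in \<open>simp add: powr_divide powr_powr\<close>)
  qed
  thus ?thesis by (rule asymp_equivI'_const) (use b w in auto)
qed

theorem theorem3:
  fixes \<beta> t\<^sub>0 :: real and f :: "real \<Rightarrow> real"
  assumes "\<beta> < 0"
    and "is_solution_on \<beta> {t\<^sub>0..} f"
    and "\<not> f constant_on {t\<^sub>0..}"
    and "(deriv_on {t\<^sub>0..} f \<longlongrightarrow> 0) at_top"
    and "\<not> bounded (f ` {t\<^sub>0..})"
  shows "\<exists>c>0. asymp_equiv (\<lambda>t. \<bar>f t\<bar>) at_top (\<lambda>t. c * t powr (1 / (1 - \<beta>)))"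
proof -
  define D where "D = deriv_on {t\<^sub>0..}"
  \<comment> \<open>Starting after the endpoint makes all derivatives two-sided.\<close>
  define a where "a = t\<^sub>0 + 1"
  note sol = solution_derivatives[OF assms(2), folded D_def]
  have d0: "(f has_real_derivative D f t) (at t)"
    and d1: "(D f has_real_derivative D (D f) t) (at t)"
    and d2: "(D (D f) has_real_derivative D (D (D f)) t) (at t)"
    and ode: "D (D (D f)) t + f t * D (D f) t - \<beta> * (D f t)\<^sup>2 = 0" if "t \<ge> a" for t
    using sol[of t] that by (simp_all add: a_def)
  have ineq: "D (D (D f)) t + f t * D (D f) t \<le> 0" if "t \<ge> a" for t
  proof -
    have "\<beta> * (D f t)\<^sup>2 \<le> 0" using assms(1) by (simp add: mult_nonpos_nonneg)
    thus ?thesis using ode[OF that] by linarith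
  qed
  have unb: "\<not> bounded (f ` {a..})"
  proof
    assume "bounded (f ` {a..})"
    moreover have "f differentiable_on {t\<^sub>0..}"
      using assms(2) unfolding is_solution_on_def three_times_differentiable_on_def
      by (auto dest: spec[of _ 0])
    hence "continuous_on {t\<^sub>0..a} f"
      by (intro continuous_on_subset[OF differentiable_imp_continuous_on]) auto
    hence "bounded (f ` {t\<^sub>0..a})"
      by (intro compact_imp_bounded compact_continuous_image) auto
    ultimately have "bounded (f ` {t\<^sub>0..a} \<union> f ` {a..})" by simp
    moreover have "{t\<^sub>0..} = {t\<^sub>0..a} \<union> {a..}" by (auto simp: a_def)
    ultimately show False using assms(5) by (simp add: image_Un)
  qed
  obtain s T where s: "s = 1 \<or> s = -1" and T: "T \<ge> a"
    and slope: "\<And>t. t \<ge> T \<Longrightarrow> s * D f t > 0" and concave: "\<And>t. t \<ge> T \<Longrightarrow> s * D (D f) t \<le> 0"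
    and inf: "filterlim (\<lambda>t. s * f t) at_top at_top"
    using monotone_concave_normal_form[OF d0 d1 d2 ineq assms(4)[folded D_def] unb] by blast
  have g0: "((\<lambda>t. s * f t) has_real_derivative s * D f t) (at t)"
    and g1: "((\<lambda>t. s * D f t) has_real_derivative s * D (D f) t) (at t)"
    and g2: "((\<lambda>t. s * D (D f) t) has_real_derivative s * D (D (D f)) t) (at t)"
    if "t \<ge> T" for t
    using d0[of t] d1[of t] d2[of t] that T by (auto intro!: DERIV_cmult)
  \<comment> \<open>The equation is not odd in \<open>f\<close>: since \<open>s\<^sup>2 = 1\<close>, the sign survives in front of
    the third derivative only.\<close>
  have gode: "s * (s * D (D (D f)) t) + (s * f t) * (s * D (D f) t) + (-\<beta>) * (s * D f t)\<^sup>2 = 0"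
    if "t \<ge> T" for t
    using ode[of t] that T s by (auto simp: power2_eq_square)
  have glim: "((\<lambda>t. s * D f t) \<longlongrightarrow> 0) at_top"
    using tendsto_mult_right_zero[OF assms(4)] by (simp add: D_def)
  have "\<forall>\<^sub>F t in at_top. - (s * D (D f) t) \<le> s * D f t"
    by (rule curvature_dominated_by_slope[OF s g0 g1 g2 gode slope glim inf])
  then obtain T' where T': "T' \<ge> T" "\<And>t. t \<ge> T' \<Longrightarrow> - (s * D (D f) t) \<le> s * D f t"
    unfolding eventually_at_top_linorder by (metis linorder_linear order_trans)
  have "\<exists>w>0. ((\<lambda>t. (s * f t) powr (-\<beta>) * (s * D f t)) \<longlongrightarrow> w) at_top"
  proof (rule power_weighted_slope_convergent[OF s g0 g1 g2 gode slope _ inf])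
    fix t assume t: "t \<ge> T'"
    show "\<bar>s * D (D f) t\<bar> \<le> s * D f t"
      using T'(2)[OF t] concave[of t] T'(1) t by linarith
  qed (use T'(1) in auto)
  then obtain w where w: "w > 0"
    and wlim: "((\<lambda>t. (s * f t) powr (-\<beta>) * (s * D f t)) \<longlongrightarrow> w) at_top" by blast
  define c where "c = ((-\<beta> + 1) * w) powr (1 / (-\<beta> + 1))"
  have "(\<lambda>t. s * f t) \<sim>[at_top] (\<lambda>t. c * t powr (1 / (-\<beta> + 1)))"
    unfolding c_def
    by (rule power_growth_from_weighted_slope[OF _ g0 inf w wlim]) (use assms(1) in auto)
  moreover have "\<forall>\<^sub>F t in at_top. s * f t = \<bar>f t\<bar>"
  proof -
    have "\<forall>\<^sub>F t in at_top. s * f t > 0" using inf by (simp add: filterlim_at_top_dense)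
    thus ?thesis by eventually_elim (use s in auto)
  qed
  ultimately have "(\<lambda>t. \<bar>f t\<bar>) \<sim>[at_top] (\<lambda>t. c * t powr (1 / (1 - \<beta>)))"
    using asymp_equiv_transfer by fastforce
  moreover have "c > 0" using w assms(1) by (simp add: c_def)
  ultimately show ?thesis by blast
qed

end
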